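(* The number of samples required to learn graphical games over $n$ players and in-degree of at most $k$ is $\Omega(k\log n)$. Here "learning" means recovering the PSNE set, and the number of samples required is the number of samples $m$ below which PSNE recovery fails with probability greater than $\tfrac12$, failure being measured by the minimum estimation error $$p_{\mathrm{err}}=\min_{\psi}\ \max_{\mathcal{G}^*\in\mathfrak{G}_n}\ \Pr\{\mathcal{NE}(\psi(\mathcal{D}))\ne\mathcal{NE}(\mathcal{G}^* )\},$$ where $\mathfrak{G}_n$ is the ensemble of $n$-player games in which every player has in-degree at most $k$, the minimum is over all decoders $\psi$, and the probability is over the distribution of the data set $\mathcal{D}$ of $m$ joint actions.
   Context: The games are linear influence games (graphical games with binary actions and linear payoffs): a game on players $\{1,\dots,n\}$ is a pair $\mathcal{G}=(\mathbf{W},\mathbf{b})$ with $\mathbf{W}=(w_{ij})\in\mathbb{R}^{n\times n}$ having zero diagonal and $\mathbf{b}\in\mathbb{R}^n$. The joint action space is $\mathcal{X}=\{-1,+1\}^n$, and the payoff of player $i$ is $x_i(\sum_{j\ne i}w_{ij}x_j-b_i)$. The PSNE (pure-strategy Nash equilibria) set is $\mathcal{NE}(\mathcal{G})=\{\mathbf{x}\in\mathcal{X} : x_i(\sum_{j\ne i}w_{ij}x_j-b_i)\ge 0 \text{ for all } i\}$. The game is represented by a directed graph on the players, with an arc from $j$ to $i$ when $w_{ij}\neq 0$; the in-degree of player $i$ is the number of $j\ne i$ with $w_{ij}\ne 0$. Setting: nature picks a true game $\mathcal{G}^*\in\mathfrak{G}_n$ and then generates a data set $\mathcal{D}$ of $m$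 joint actions in $\mathcal{X}$, sampled independently and identically from some distribution $\mathcal{P}$ (a noisy observation model associated with $\mathcal{G}^*$; the statement does not specify it further). A decoder is any function $\psi:\mathcal{X}^m\to\mathfrak{G}_n$ that maps a data set to a game in $\mathfrak{G}_n$. *)

theory Defs
  imports "HOL-Probability.Probability"
begin

text \<open>
  The constant in the lower bound is uniform in the number of players \<open>n\<close>, so \<open>n\<close> is a number rather
  than a type. Matrices, vectors and joint actions are extensional functions on \<open>{1..n}\<close>, which makes
  their representation unique.
\<close>

type_synonym game = "(nat \<Rightarrow> nat \<Rightarrow> real) \<times> (nat \<Rightarrow> real)"

definition influence_games :: "nat \<Rightarrow> game set" where
  "influence_games n =
     {(W, b). W \<in> {1..n} \<rightarrow>\<^sub>E ({1..n} \<rightarrow>\<^sub>E UNIV) \<and> (\<forall>i\<in>{1..n}. W i i = 0) \<and> b \<in> {1..n} \<rightarrow>\<^sub>E UNIV}"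

definition joint_actions :: "nat \<Rightarrow> (nat \<Rightarrow> real) set" where
  "joint_actions n = {1..n} \<rightarrow>\<^sub>E {-1, 1}"

definition payoff :: "nat \<Rightarrow> game \<Rightarrow> nat \<Rightarrow> (nat \<Rightarrow> real) \<Rightarrow> real" where
  "payoff n G i x = x i * ((\<Sum>j\<in>{1..n} - {i}. fst G i j * x j) - snd G i)"

definition psne :: "nat \<Rightarrow> game \<Rightarrow> (nat \<Rightarrow> real) set" where
  "psne n G = {x \<in> joint_actions n. \<forall>i\<in>{1..n}. payoff n G i x \<ge> 0}"

definition in_degree :: "nat \<Rightarrow> game \<Rightarrow> nat \<Rightarrow> nat" where
  "in_degree n G i = card {j \<in> {1..n} - {i}. fst G i j \<noteq> 0}"

definition ensemble :: "nat \<Rightarrow> nat \<Rightarrow> game set" where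
  "ensemble n k = {G \<in> influence_games n. \<forall>i\<in>{1..n}. in_degree n G i \<le> k}"

definition datasets :: "nat \<Rightarrow> nat \<Rightarrow> (nat \<Rightarrow> real) list set" where
  "datasets n m = {D. length D = m \<and> set D \<subseteq> joint_actions n}"

definition decoders :: "nat \<Rightarrow> nat \<Rightarrow> nat \<Rightarrow> ((nat \<Rightarrow> real) list \<Rightarrow> game) set" where
  "decoders n k m = datasets n m \<rightarrow> ensemble n k"

text \<open>
  An observation model assigns to each true game the distribution of a single observed joint action;
  nothing else is assumed about it.
\<close>

definition observation_model :: "nat \<Rightarrow> nat \<Rightarrow> (game \<Rightarrow> (nat \<Rightarrow> real) pmf) \<Rightarrow> bool" where
  "observation_model n k P \<longleftrightarrow> (\<forall>G\<in>ensemble n k. set_pmf (P G) \<subseteq> joint_actions n)"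

text \<open>
  The ensemble is infinite, so the maximum over true games is a supremum. The infimum over decoders
  is a minimum: only the finitely many functions \<open>D \<mapsto> psne n (\<psi> D)\<close> on \<open>datasets n m\<close> matter.
\<close>

definition p_err :: "nat \<Rightarrow> nat \<Rightarrow> nat \<Rightarrow> (game \<Rightarrow> (nat \<Rightarrow> real) pmf) \<Rightarrow> real" where
  "p_err n k m P =
     (INF \<psi>\<in>decoders n k m. SUP G\<in>ensemble n k.
        measure_pmf.prob (replicate_pmf m (P G)) {D. psne n (\<psi> D) \<noteq> psne n G})"

text \<open>
  The largest threshold below which recovery fails. It is infinite if no number of samples suffices,
  for instance when \<open>n > 0\<close> and all games induce the same distribution.
\<close>

definition samples_required :: "nat \<Rightarrow> nat \<Rightarrow> (game \<Rightarrow> (nat \<Rightarrow> real) pmf) \<Rightarrow> enat" where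
  "samples_required n k P = Sup {M. \<forall>m. enat m < M \<longrightarrow> p_err n k m P > 1 / 2}"

end

theory Submission
  imports Defs
begin

text \<open>
  Pigeonhole: there are \<open>2 ^ (n * m)\<close> data sets, so if more PSNE sets than that occur in the ensemble,
  then one of them is never the PSNE set of a decoded game, and the decoder fails on it with
  probability 1, whatever the observation model.

  To produce many PSNE sets, let the players \<open>1, \<dots>, a\<close> be indifferent, and let every other player
  copy the sign of a linear threshold function of their actions. The PSNE set is then the
  graph of a tuple of threshold functions, so it suffices to count threshold functions of \<open>a\<close>
  variables of which at most \<open>k\<close> matter. Half of these \<open>k\<close> variables are a fixed set
  of \<open>p\<close> variables with weight 1, by which the other weights can be measured up to \<open>p + 1\<close>. The remaining
  \<open>q\<close> variables and their weights are arbitrary, which yields \<open>(a - p choose q) * (p + 1) ^ q\<close>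
  functions. The weights are essential: when \<open>k\<close> is proportional to \<open>n\<close>, the choice of the
  variables alone loses the factor \<open>ln n\<close>.
\<close>

section \<open>Pigeonhole bound on the decoding error\<close>

lemma finite_joint_actions: "finite (joint_actions n)"
  unfolding joint_actions_def by (intro finite_PiE) auto

lemma card_joint_actions: "card (joint_actions n) = 2 ^ n"
  unfolding joint_actions_def by (simp add: card_PiE numeral_2_eq_2)

lemma finite_datasets: "finite (datasets n m)"
  using finite_lists_length_eq[OF finite_joint_actions[of n], of m]
  by (simp add: datasets_def conj_commute)

lemma card_datasets: "card (datasets n m) = 2 ^ (n * m)"
  using card_lists_length_eq[OF finite_joint_actions[of n], of m]
  by (simp add: datasets_def conj_commute card_joint_actions power_mult)

lemma finite_psne_image: "finite (psne n ` E)"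
proof (rule finite_subset)
  show "psne n ` E \<subseteq> Pow (joint_actions n)"
    by (auto simp: psne_def)
qed (simp add: finite_joint_actions)

lemma p_err_ge_1:
  assumes P: "observation_model n k P"
    and card: "2 ^ (n * m) < card (psne n ` ensemble n k)"
  shows "p_err n k m P \<ge> 1"
  unfolding p_err_def
proof (rule cINF_greatest)
  have "ensemble n k \<noteq> {}"
    using card by auto
  then show "decoders n k m \<noteq> {}"
    by (auto simp: decoders_def)
next
  fix \<psi> assume \<psi>: "\<psi> \<in> decoders n k m"
  let ?err = "\<lambda>G. measure_pmf.prob (replicate_pmf m (P G)) {D. psne n (\<psi> D) \<noteq> psne n G}"
  have "card ((\<lambda>D. psne n (\<psi> D)) ` datasets n m) \<le> 2 ^ (n * m)"
    using card_image_le[OF finite_datasets] by (metis card_datasets)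
  then have "\<not> psne n ` ensemble n k \<subseteq> (\<lambda>D. psne n (\<psi> D)) ` datasets n m"
    using card card_mono[OF finite_imageI[OF finite_datasets]]
    by (meson le_trans not_less)
  then obtain G where G: "G \<in> ensemble n k"
    and miss: "psne n G \<notin> (\<lambda>D. psne n (\<psi> D)) ` datasets n m"
    by blast
  have "set_pmf (replicate_pmf m (P G)) \<subseteq> datasets n m"
    using P G by (auto simp: set_replicate_pmf datasets_def observation_model_def)
  then have "?err G = 1"
    using miss by (subst measure_pmf.prob_eq_1) (auto simp: AE_measure_pmf_iff)
  moreover have "?err G \<le> (SUP G\<in>ensemble n k. ?err G)"
    using G by (intro cSUP_upper) (auto intro!: bdd_aboveI2[where M = 1])
  ultimately show "1 \<le> (SUP G\<in>ensemble n k. ?err G)"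
    by simp
qed

text \<open>For natural \<open>m\<close>, being below \<open>r\<close> is the same as being below
  its ceiling, so the ceiling belongs to the set whose supremum is
  \<open>samples_required\<close>.\<close>

lemma le_samples_required:
  assumes "\<And>m. real m < r \<Longrightarrow> p_err n k m P > 1 / 2"
  shows "ereal r \<le> ereal_of_enat (samples_required n k P)"
proof -
  have "enat (nat \<lceil>r\<rceil>) \<le> samples_required n k P"
    unfolding samples_required_def
    using assms by (intro Sup_upper) (auto simp: less_ceiling_iff zless_nat_eq_int_zless)
  then have "ereal_of_enat (enat (nat \<lceil>r\<rceil>)) \<le> ereal_of_enat (samples_required n k P)"
    by (simp only: ereal_of_enat_le_iff)
  moreover have "ereal r \<le> ereal_of_enat (enat (nat \<lceil>r\<rceil>))"
    by (simp add: real_nat_ceiling_ge)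
  ultimately show ?thesis
    by (rule order_trans[rotated])
qed

section \<open>Two PSNE sets without any arcs\<close>

lemma ensemble_mono: "k \<le> l \<Longrightarrow> ensemble n k \<subseteq> ensemble n l"
  unfolding ensemble_def by (auto intro: le_trans)

text \<open>With zero weights, bias 0 admits every joint action, while bias 1 forces all players to
  play -1. This settles small \<open>n\<close>, where only \<open>m = 0\<close> has to be
  excluded.\<close>

lemma two_le_card_psne:
  assumes "n \<ge> 1"
  shows "2 \<le> card (psne n ` ensemble n k)"
proof -
  define Z where "Z = (\<lambda>i\<in>{1..n}. \<lambda>j\<in>{1..n}. 0 :: real)"
  define G where "G = (\<lambda>c. (Z, \<lambda>i\<in>{1..n}. c :: real))"
  have "in_degree n (G c) i = 0" if "i \<in> {1..n}" for c i
    using that by (simp add: in_degree_def G_def Z_def)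
  then have G: "G c \<in> ensemble n k" for c
    by (auto simp: ensemble_def influence_games_def G_def Z_def)
  have payoff: "payoff n (G c) i x = - c * x i" if "i \<in> {1..n}" for c i x
    using that by (simp add: payoff_def G_def Z_def)
  let ?x = "\<lambda>i\<in>{1..n}. 1 :: real"
  have "?x \<in> psne n (G 0)" "?x \<notin> psne n (G 1)"
    using assms by (auto simp: psne_def joint_actions_def payoff)
  then have "card {psne n (G 0), psne n (G 1)} = 2"
    by (subst card_2_iff) blast
  moreover have "card {psne n (G 0), psne n (G 1)} \<le> card (psne n ` ensemble n k)"
    using G by (intro card_mono finite_psne_image) auto
  ultimately show ?thesis
    by simp
qed

section \<open>Threshold games and their PSNE sets\<close>

text \<open>
  With bias 0 and no incoming arcs the players up to \<open>a\<close> are indifferent. The biases of the others make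
  the threshold test \<open>2 * (t + u i j) > 2 * p + 1\<close> when exactly \<open>t\<close> of the players up to \<open>p\<close> and, among
  the players from \<open>p + 1\<close> to \<open>a\<close>, only \<open>j\<close> plays 1.
\<close>

definition threshold_game :: "nat \<Rightarrow> nat \<Rightarrow> nat \<Rightarrow> (nat \<Rightarrow> nat \<Rightarrow> nat) \<Rightarrow> game" where
  "threshold_game n a p u =
     (\<lambda>i\<in>{1..n}. \<lambda>j\<in>{1..n}. if a < i \<and> j \<le> a then (if j \<le> p then 1 else real (u i j)) else 0,
      \<lambda>i\<in>{1..n}. if a < i then real p + 1 - (\<Sum>j\<in>{p<..a}. real (u i j)) else 0)"

text \<open>The possible rows \<open>u i\<close>: the support bound keeps the in-degree within
  \<open>p + q\<close>, and weights up to \<open>p + 1\<close> are those that the \<open>p\<close>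
  unit weights can tell apart.\<close>

definition sparse_weights :: "nat \<Rightarrow> nat \<Rightarrow> nat \<Rightarrow> (nat \<Rightarrow> nat) set" where
  "sparse_weights a p q = {v \<in> {p<..a} \<rightarrow>\<^sub>E {0..p + 1}. card {j \<in> {p<..a}. v j \<noteq> 0} \<le> q}"

lemma payoff_threshold_game_input:
  assumes "i \<in> {1..n}" "i \<le> a"
  shows "payoff n (threshold_game n a p u) i x = 0"
  using assms by (auto simp: payoff_def threshold_game_def intro!: sum.neutral)

text \<open>The sum in the bias turns \<open>x j\<close> into \<open>x j + 1\<close>, so a weighted
  player who plays -1 contributes nothing.\<close>

lemma payoff_threshold_game_output:
  assumes i: "i \<in> {1..n}" "a < i" and "p \<le> a"
  shows "payoff n (threshold_game n a p u) i x =
    x i * ((\<Sum>j\<in>{1..p}. x j) + (\<Sum>j\<in>{p<..a}. real (u i j) * (x j + 1)) - real p - 1)"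
proof -
  have "(\<Sum>j\<in>{1..n} - {i}. fst (threshold_game n a p u) i j * x j) =
      (\<Sum>j\<in>{1..a}. (if j \<le> p then 1 else real (u i j)) * x j)"
    using i by (intro sum.mono_neutral_cong_right) (auto simp: threshold_game_def)
  also have "{1..a} = {1..p} \<union> {p<..a}"
    using \<open>p \<le> a\<close> by auto
  also have "(\<Sum>j\<in>{1..p} \<union> {p<..a}. (if j \<le> p then 1 else real (u i j)) * x j) =
      (\<Sum>j\<in>{1..p}. x j) + (\<Sum>j\<in>{p<..a}. real (u i j) * x j)"
    by (subst sum.union_disjoint) (auto intro!: arg_cong2[where f = "(+)"] sum.cong)
  finally show ?thesis
    using i by (simp add: payoff_def threshold_game_def algebra_simps sum.distrib)
qed

lemma threshold_game_in_ensemble: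
  assumes u: "u \<in> {a<..n} \<rightarrow> sparse_weights a p q" and "p \<le> a"
  shows "threshold_game n a p u \<in> ensemble n (p + q)"
proof -
  have "in_degree n (threshold_game n a p u) i \<le> p + q" if i: "i \<in> {1..n}" for i
  proof (cases "a < i")
    case True
    with u i have "card {j \<in> {p<..a}. u i j \<noteq> 0} \<le> q"
      by (auto simp: sparse_weights_def Pi_iff)
    then have "card ({1..p} \<union> {j \<in> {p<..a}. u i j \<noteq> 0}) \<le> p + q"
      by (intro order_trans[OF card_Un_le]) simp
    moreover have "in_degree n (threshold_game n a p u) i \<le> card ({1..p} \<union> {j \<in> {p<..a}. u i j \<noteq> 0})"
      unfolding in_degree_def
      using i by (intro card_mono) (auto simp: threshold_game_def split: if_splits)
    ultimately show ?thesis
      by (rule order_trans[rotated])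
  next
    case False
    with i have "{j \<in> {1..n} - {i}. fst (threshold_game n a p u) i j \<noteq> 0} = {}"
      by (auto simp: threshold_game_def)
    then show ?thesis
      unfolding in_degree_def by (simp only: card.empty)
  qed
  then show ?thesis
    by (auto simp: ensemble_def influence_games_def threshold_game_def)
qed

text \<open>An input on which the weight \<open>u i j\<close> just passes the test extends to an
  equilibrium for \<open>u\<close> in which \<open>i\<close> plays 1. For this to be an equilibrium
  for \<open>v\<close> too, \<open>v i j\<close> must pass the same test.\<close>

lemma threshold_game_psne_subset_imp_le:
  assumes sub: "psne n (threshold_game n a p u) \<subseteq> psne n (threshold_game n a p v)"
    and "p \<le> a" and i: "i \<in> {a<..n}" and j: "j \<in> {p<..a}" and u: "u i j \<le> p + 1"
  shows "u i j \<le> v i j"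
proof (cases "u i j = 0")
  case False
  \<comment> \<open>The least number of ones among the unit-weight players with which weight
    \<open>u i j\<close> passes; any smaller weight fails.\<close>
  define t where "t = p + 1 - u i j"
  have t: "t \<le> p" "t + u i j = p + 1"
    using False u by (auto simp: t_def)
  \<comment> \<open>Players above \<open>a\<close> answer according to \<open>u\<close>, which makes
    \<open>x\<close> an equilibrium of the first game.\<close>
  define x :: "nat \<Rightarrow> real" where
    "x = (\<lambda>l\<in>{1..n}. if (if l \<le> a then l \<le> t \<or> l = j else p < t + u l j) then 1 else -1)"
  have x: "x \<in> joint_actions n"
    by (auto simp: x_def joint_actions_def)
  have "(\<Sum>l\<in>{1..p}. x l) = (\<Sum>l\<in>{1..p}. 2 * of_bool (l \<le> t) - 1)"
    using i j t by (intro sum.cong) (auto simp: x_def)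
  also have "\<dots> = 2 * real (card {l \<in> {1..p}. l \<le> t}) - real p"
    by (simp add: sum_subtractf sum_distrib_left[symmetric] sum_of_bool_eq Int_def)
  also have "{l \<in> {1..p}. l \<le> t} = {1..t}"
    using t by auto
  finally have low: "(\<Sum>l\<in>{1..p}. x l) = 2 * real t - real p"
    by simp
  have high: "(\<Sum>l\<in>{p<..a}. real (w l) * (x l + 1)) = 2 * real (w j)" for w
  proof -
    have "(\<Sum>l\<in>{p<..a}. real (w l) * (x l + 1)) = (\<Sum>l\<in>{p<..a}. if l = j then 2 * real (w j) else 0)"
      using i j t by (intro sum.cong) (auto simp: x_def)
    then show ?thesis
      using j by simp
  qed
  have payoff: "payoff n (threshold_game n a p w) l x =
      x l * (2 * real (t + w l j) - (2 * real p + 1))" if "l \<in> {a<..n}" for w l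
    using that \<open>p \<le> a\<close> by (subst payoff_threshold_game_output) (auto simp only: low high, auto)
  have "payoff n (threshold_game n a p u) l x \<ge> 0" if l: "l \<in> {1..n}" for l
  proof (cases "l \<le> a")
    case True
    with l show ?thesis
      by (simp add: payoff_threshold_game_input)
  next
    case False
    with l have "x l = (if p < t + u l j then 1 else -1)"
      by (simp add: x_def)
    with l False show ?thesis
      by (simp add: payoff)
  qed
  with x sub have "x \<in> psne n (threshold_game n a p v)"
    by (auto simp: psne_def)
  with i have "payoff n (threshold_game n a p v) i x \<ge> 0"
    by (auto simp: psne_def)
  moreover have "x i = 1"
    using i t by (auto simp: x_def)
  \<comment> \<open>The left side is odd and the right side even, so in fact
    \<open>p + 1 \<le> t + v i j\<close>.\<close>
  ultimately have "2 * p + 1 \<le> 2 * (t + v i j)"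
    using i by (simp add: payoff)
  with t show ?thesis
    by simp
qed simp

lemma inj_on_psne_threshold_game:
  assumes "p \<le> a"
  shows "inj_on (\<lambda>u. psne n (threshold_game n a p u)) ({a<..n} \<rightarrow>\<^sub>E sparse_weights a p q)"
proof (rule inj_onI)
  fix u v
  assume u: "u \<in> {a<..n} \<rightarrow>\<^sub>E sparse_weights a p q" and v: "v \<in> {a<..n} \<rightarrow>\<^sub>E sparse_weights a p q"
    and eq: "psne n (threshold_game n a p u) = psne n (threshold_game n a p v)"
  show "u = v"
  proof (rule PiE_ext[OF u v])
    fix i assume i: "i \<in> {a<..n}"
    have ui: "u i \<in> {p<..a} \<rightarrow>\<^sub>E {0..p + 1}" and vi: "v i \<in> {p<..a} \<rightarrow>\<^sub>E {0..p + 1}"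
      using PiE_mem[OF u i] PiE_mem[OF v i] by (simp_all add: sparse_weights_def)
    show "u i = v i"
    proof (rule PiE_ext[OF ui vi])
      fix j assume j: "j \<in> {p<..a}"
      then have "u i j \<le> p + 1" "v i j \<le> p + 1"
        using PiE_mem[OF ui j] PiE_mem[OF vi j] by auto
      then show "u i j = v i j"
        using threshold_game_psne_subset_imp_le[OF equalityD1[OF eq] assms i j]
          threshold_game_psne_subset_imp_le[OF equalityD2[OF eq] assms i j] by simp
    qed
  qed
qed

section \<open>Counting sparse weight vectors\<close>

lemma finite_sparse_weights: "finite (sparse_weights a p q)"
  unfolding sparse_weights_def by (rule finite_subset[OF Collect_subset]) (auto intro!: finite_PiE)

text \<open>Each of the \<open>n - a\<close> players above \<open>a\<close> carries its own weight
  vector, chosen independently.\<close>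

lemma card_sparse_weights_power_le:
  assumes "p \<le> a" "a \<le> n"
  shows "card (sparse_weights a p q) ^ (n - a) \<le> card (psne n ` ensemble n (p + q))"
proof -
  let ?U = "{a<..n} \<rightarrow>\<^sub>E sparse_weights a p q"
  have "card (sparse_weights a p q) ^ (n - a) = card ?U"
    by (simp add: card_PiE)
  also have "\<dots> = card ((\<lambda>u. psne n (threshold_game n a p u)) ` ?U)"
    using inj_on_psne_threshold_game[OF assms(1)] by (simp add: card_image)
  also have "\<dots> \<le> card (psne n ` ensemble n (p + q))"
    using threshold_game_in_ensemble[OF _ assms(1)]
    by (intro card_mono finite_psne_image) (auto simp: PiE_def)
  finally show ?thesis .
qed

lemma card_sparse_weights_ge:
  "(a - p choose q) * (p + 1) ^ q \<le> card (sparse_weights a p q)"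
proof -
  define \<S> where "\<S> = {S. S \<subseteq> {p<..a} \<and> card S = q}"
  \<comment> \<open>The values start at 1, so that \<open>S\<close> can be recovered as the support
    after extension by 0.\<close>
  let ?T = "SIGMA S:\<S>. S \<rightarrow>\<^sub>E {1..p + 1}"
  let ?ext = "\<lambda>(S, f). \<lambda>j\<in>{p<..a}. if j \<in> S then f j else (0 :: nat)"
  have fin: "finite S" if "S \<in> \<S>" for S
    using that by (auto simp: \<S>_def intro: finite_subset)
  have supp: "{j \<in> {p<..a}. ?ext (S, f) j \<noteq> 0} = S" if "(S, f) \<in> ?T" for S f
    using that by (force simp: \<S>_def dest: PiE_mem)
  have "inj_on ?ext ?T"
  proof (rule inj_onI, clarify)
    fix S f S' f'
    assume S: "S \<in> \<S>" and f: "f \<in> S \<rightarrow>\<^sub>E {1..p + 1}" and S': "S' \<in> \<S>" and f': "f' \<in> S' \<rightarrow>\<^sub>E {1..p + 1}"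
      and eq: "(\<lambda>j\<in>{p<..a}. if j \<in> S then f j else 0) = (\<lambda>j\<in>{p<..a}. if j \<in> S' then f' j else 0)"
    have "S = S'"
      using supp[of S f] supp[of S' f'] S f S' f' eq by simp
    moreover have "f = f'"
    proof (rule PiE_ext[OF f])
      show "f' \<in> S \<rightarrow>\<^sub>E {1..p + 1}"
        using f' \<open>S = S'\<close> by simp
      show "f j = f' j" if "j \<in> S" for j
        using fun_cong[OF eq, of j] that S \<open>S = S'\<close> by (auto simp: \<S>_def restrict_def split: if_splits)
    qed
    ultimately show "S = S' \<and> f = f'"
      by simp
  qed
  moreover have "?ext ` ?T \<subseteq> sparse_weights a p q"
  proof clarify
    fix S f assume S: "S \<in> \<S>" and f: "f \<in> S \<rightarrow>\<^sub>E {1..p + 1}"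
    have "(\<lambda>j\<in>{p<..a}. if j \<in> S then f j else 0) \<in> {p<..a} \<rightarrow>\<^sub>E {0..p + 1}"
      using PiE_mem[OF f] by auto
    moreover have "card {j \<in> {p<..a}. ?ext (S, f) j \<noteq> 0} \<le> q"
      using supp[of S f] S f by (simp add: \<S>_def)
    ultimately show "(\<lambda>j\<in>{p<..a}. if j \<in> S then f j else 0) \<in> sparse_weights a p q"
      by (simp add: sparse_weights_def)
  qed
  ultimately have "card ?T \<le> card (sparse_weights a p q)"
    using finite_sparse_weights by (rule card_inj_on_le)
  moreover have "card ?T = (a - p choose q) * (p + 1) ^ q"
  proof -
    have "finite \<S>"
      by (simp add: \<S>_def)
    then have "card ?T = (\<Sum>S\<in>\<S>. card (S \<rightarrow>\<^sub>E {1..p + 1}))"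
      using fin by (intro card_SigmaI) (auto intro!: finite_PiE)
    also have "\<dots> = (\<Sum>S\<in>\<S>. (p + 1) ^ q)"
      using fin by (intro sum.cong) (auto simp: card_PiE \<S>_def)
    also have "\<dots> = (a - p choose q) * (p + 1) ^ q"
      using n_subsets[of "{p<..a}" q] by (simp add: \<S>_def)
    finally show ?thesis .
  qed
  ultimately show ?thesis
    by simp
qed

text \<open>The binomial coefficient is at least \<open>((a - p) / q) ^ q\<close>, and the choice of
  weights makes up for the loss of \<open>q ^ q\<close> because
  \<open>q \<le> p + 1\<close>.\<close>

lemma power_le_card_sparse_weights:
  assumes "q \<le> a - p" "q \<le> p + 1"
  shows "(a - p) ^ q \<le> card (sparse_weights a p q)"
proof (cases "q = 0")
  case True
  then show ?thesis
    using card_sparse_weights_ge[of a p q] by simp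
next
  case False
  have "real ((a - p) ^ q) = (real (a - p) / real q) ^ q * real q ^ q"
    using False by (simp add: power_divide)
  also have "\<dots> \<le> real (a - p choose q) * real (p + 1) ^ q"
    using assms binomial_ge_n_over_k_pow_k[OF assms(1), where 'a = real]
    by (intro mult_mono power_mono) auto
  also have "\<dots> = real ((a - p choose q) * (p + 1) ^ q)"
    by simp
  also have "\<dots> \<le> real (card (sparse_weights a p q))"
    using card_sparse_weights_ge of_nat_le_iff by blast
  finally show ?thesis
    by simp
qed

section \<open>Choice of parameters and the final bound\<close>

lemma ln_card_psne_ge:
  assumes "k < n" "20 \<le> n"
  shows "real n * (real k * ln (real n)) / 16 \<le> ln (real (card (psne n ` ensemble n k)))"
proof -
  \<comment> \<open>Half of the players are inputs. Capping \<open>k\<close> at \<open>a\<close>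
    costs at most a factor 2, since \<open>k < n\<close>, and halving it costs another: hence
    \<open>k \<le> 4 * q\<close>.\<close>
  define a where "a = n div 2"
  define K where "K = min k a"
  define p where "p = K div 2"
  define q where "q = K - p"
  have "K \<le> a" "K = k \<or> K = a" "K \<le> k"
    by (auto simp: K_def)
  then have q: "k \<le> 4 * q" "q \<le> a - p" "q \<le> p + 1" "p + q \<le> k" "p \<le> a" "a \<le> n" "n \<le> 2 * (n - a)"
    using assms unfolding p_def q_def a_def by linarith+
  have ap: "n \<le> 4 * (a - p) + 1"
    using \<open>K \<le> a\<close> unfolding a_def p_def by linarith
  \<comment> \<open>This is where \<open>20 \<le> n\<close> enters. It gives
    \<open>n \<le> (a - p) ^ 2\<close>, so replacing \<open>ln n\<close> by
    \<open>ln (a - p)\<close> costs only a factor 2.\<close>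
  have "16 * real n \<le> (real n - 1) ^ 2"
  proof -
    have "real n * 20 \<le> real n * real n"
      using assms by (intro mult_left_mono) auto
    moreover have "(real n - 1) ^ 2 = real n * real n - 2 * real n + 1"
      by (simp add: power2_eq_square algebra_simps)
    ultimately show ?thesis
      using assms by linarith
  qed
  also have "\<dots> \<le> (4 * real (a - p)) ^ 2"
    using ap assms by (intro power_mono) linarith+
  finally have "real n \<le> real (a - p) ^ 2"
    by (simp add: power_mult_distrib)
  then have "ln (real n) \<le> ln (real (a - p) ^ 2)"
    using assms by (intro ln_mono) auto
  moreover have pos: "0 < a - p"
    using ap assms by linarith
  ultimately have ln: "ln (real n) \<le> 2 * ln (real (a - p))"
    by (simp add: ln_realpow)
  have "(a - p) ^ (q * (n - a)) \<le> card (sparse_weights a p q) ^ (n - a)"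
    using power_mono[OF power_le_card_sparse_weights[OF q(2,3)]] by (simp add: power_mult)
  also have "\<dots> \<le> card (psne n ` ensemble n (p + q))"
    using q by (intro card_sparse_weights_power_le)
  also have "\<dots> \<le> card (psne n ` ensemble n k)"
    using ensemble_mono[OF q(4)] by (intro card_mono finite_psne_image image_mono)
  finally have "real (a - p) ^ (q * (n - a)) \<le> real (card (psne n ` ensemble n k))"
    by (metis of_nat_le_iff of_nat_power)
  then have "ln (real (a - p) ^ (q * (n - a))) \<le> ln (real (card (psne n ` ensemble n k)))"
    using pos by (intro ln_mono) auto
  then have "real q * real (n - a) * ln (real (a - p)) \<le> ln (real (card (psne n ` ensemble n k)))"
    using pos by (simp add: ln_realpow)
  moreover have "(real k / 4) * (real n / 2) * (ln (real n) / 2) \<le>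
      real q * real (n - a) * ln (real (a - p))"
    using q ln assms by (intro mult_mono) auto
  ultimately show ?thesis
    by (simp add: mult_ac)
qed

lemma two_power_less_card_psne:
  assumes "k < n" and m: "real m < 1 / 400 * (real k * ln (real n))"
  shows "2 ^ (n * m) < card (psne n ` ensemble n k)"
proof (cases "n < 20")
  case True
  \<comment> \<open>The source of the constant 1/400: for \<open>n < 20\<close> it leaves only
    \<open>m = 0\<close>. For larger \<open>n\<close>, 1/16 would do.\<close>
  have "real k * ln (real n) \<le> 20 * 20"
    using assms True ln_le_minus_one[of "real n"] by (intro mult_mono) auto
  with m have "m = 0"
    by simp
  then show ?thesis
    using two_le_card_psne[of n k] assms by simp
next
  case False
  have "0 < card (psne n ` ensemble n k)"
    using two_le_card_psne[of n k] assms by simp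
  moreover have "ln (2 ^ (n * m)) < ln (real (card (psne n ` ensemble n k)))"
  proof -
    have nonneg: "0 \<le> real k * ln (real n)"
      using False by simp
    have "ln (2 ^ (n * m)) = real n * (real m * ln 2)"
      by (simp add: ln_realpow)
    also have "\<dots> \<le> real n * (real m * 1)"
      using ln_2_less_1 by (intro mult_left_mono) auto
    also have "\<dots> < real n * ((real k * ln (real n)) / 16)"
      using False m nonneg by (intro mult_strict_left_mono) auto
    also have "\<dots> \<le> ln (real (card (psne n ` ensemble n k)))"
      using ln_card_psne_ge[of k n] assms False by simp
    finally show ?thesis .
  qed
  ultimately have "(2::real) ^ (n * m) < real (card (psne n ` ensemble n k))"
    by simp
  then show ?thesis
    by (metis of_nat_less_iff of_nat_numeral of_nat_power)
qed

theorem theorem2: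
  "\<exists>c::real. c > 0 \<and>
     (\<forall>(n::nat) (k::nat) (P :: game \<Rightarrow> (nat \<Rightarrow> real) pmf).
        k < n \<longrightarrow> observation_model n k P \<longrightarrow>
        ereal (c * (real k * ln (real n))) \<le> ereal_of_enat (samples_required n k P))"
proof (intro exI[of _ "1 / 400"] conjI allI impI)
  fix n k and P :: "game \<Rightarrow> (nat \<Rightarrow> real) pmf"
  assume "k < n" and P: "observation_model n k P"
  show "ereal (1 / 400 * (real k * ln (real n))) \<le> ereal_of_enat (samples_required n k P)"
  proof (rule le_samples_required)
    fix m assume "real m < 1 / 400 * (real k * ln (real n))"
    then have "p_err n k m P \<ge> 1"
      using P \<open>k < n\<close> by (intro p_err_ge_1 two_power_less_card_psne)
    then show "p_err n k m P > 1 / 2"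
      by simp
  qed
qed simp

end
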